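(* Let $K,L\subset\mathbb R^n$ be convex bodies and let $\theta\in[0,1]$. Then $$|K+_\theta L|^{\frac1n}\ \ge\ (1-\theta^{\frac1n})\left(|K|^{\frac1n}+|L|^{\frac1n}\right).$$ Equivalently, if $\varphi_n(\theta)$ denotes the best (largest) constant such that $|K+_\theta L|^{1/n}\ge \varphi_n(\theta)^{1/n}(|K|^{1/n}+|L|^{1/n})$ holds for all convex bodies $K,L\subset\mathbb R^n$, then $\varphi_n(\theta)\ge(1-\theta^{1/n})^n$.
   Context: A convex body in $\mathbb R^n$ is a compact convex set with non-empty interior; $|\cdot|$ denotes Lebesgue measure in $\mathbb R^n$. For convex bodies $K,L\subset\mathbb R^n$, $K+L$ is the Minkowski sum, $M(K,L)=\sup_{x\in K+L}|K\cap(x-L)|$, and for $\theta\in[0,1]$ the $\theta$-convolution is $K+_\theta L=\{x\in K+L:\ |K\cap(x-L)|\ge\theta M(K,L)\}$. *)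

theory Defs
  imports "HOL-Analysis.Analysis"
begin

definition convex_body :: "(real ^ 'n::finite) set \<Rightarrow> bool" where
  "convex_body K \<longleftrightarrow> compact K \<and> convex K \<and> interior K \<noteq> {}"

text \<open>The set \<open>x - L\<close> is written as the image \<open>(\<lambda>y. x - y) ` L\<close>, since \<open>-\<close> on sets is set difference;
  \<open>K + L\<close> on sets is the Minkowski sum.\<close>

definition max_conv :: "(real ^ 'n::finite) set \<Rightarrow> (real ^ 'n) set \<Rightarrow> real" where
  "max_conv K L = (SUP x\<in>K + L. measure lebesgue (K \<inter> (\<lambda>y. x - y) ` L))"

definition theta_conv ::
  "real \<Rightarrow> (real ^ 'n::finite) set \<Rightarrow> (real ^ 'n) set \<Rightarrow> (real ^ 'n) set" where
  "theta_conv \<theta> K L =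
     {x \<in> K + L. measure lebesgue (K \<inter> (\<lambda>y. x - y) ` L) \<ge> \<theta> * max_conv K L}"

definition admissible_const :: "'n::finite itself \<Rightarrow> real \<Rightarrow> real \<Rightarrow> bool" where
  "admissible_const _ \<theta> c \<longleftrightarrow> 0 \<le> c \<and>
     (\<forall>K L :: (real ^ 'n) set. convex_body K \<longrightarrow> convex_body L \<longrightarrow>
        root CARD('n) (measure lebesgue (theta_conv \<theta> K L))
          \<ge> root CARD('n) c *
             (root CARD('n) (measure lebesgue K) + root CARD('n) (measure lebesgue L)))"

text \<open>The dimension is the cardinality of the index type. That the largest constant exists is
  shown in \<open>best_const_admissible\<close> and \<open>best_const_greatest\<close> below.\<close>

definition best_const :: "'n::finite itself \<Rightarrow> real \<Rightarrow> real" where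
  "best_const N \<theta> = (GREATEST c. admissible_const N \<theta> c)"

lemma convex_body_measure_pos:
  fixes K :: "(real ^ 'n::finite) set"
  assumes "convex_body K"
  shows "measure lebesgue K > 0"
proof -
  have c: "compact K" and i: "interior K \<noteq> {}"
    using assms by (auto simp: convex_body_def)
  have "\<not> negligible K"
    using i open_not_negligible[OF open_interior] negligible_subset interior_subset by blast
  moreover have "K \<in> lmeasurable"
    using c by (rule lmeasurable_compact)
  ultimately show ?thesis
    by (metis measure_nonneg negligible_iff_measure order_le_less)
qed

lemma admissible_greatest_ex:
  fixes N :: "'n::finite itself"
  shows "\<exists>c. admissible_const N \<theta> c \<and> (\<forall>d. admissible_const N \<theta> d \<longrightarrow> d \<le> c)"
proof -
  define S where "S = {c. admissible_const N \<theta> c}"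
  define b where "b = (\<lambda>K L :: (real ^ 'n) set.
    (root CARD('n) (measure lebesgue (theta_conv \<theta> K L)) /
     (root CARD('n) (measure lebesgue K) + root CARD('n) (measure lebesgue L))) ^ CARD('n))"
  have n: "0 < CARD('n)" by simp
  have eq: "root CARD('n) (measure lebesgue (theta_conv \<theta> K L))
          \<ge> root CARD('n) c *
             (root CARD('n) (measure lebesgue K) + root CARD('n) (measure lebesgue L))
        \<longleftrightarrow> c \<le> b K L"
    if "convex_body K" "convex_body L" for K L :: "(real ^ 'n) set" and c
  proof -
    have pos: "0 < root CARD('n) (measure lebesgue K) + root CARD('n) (measure lebesgue L)"
      using that convex_body_measure_pos n by (intro add_pos_pos) auto
    have "0 \<le> root CARD('n) (measure lebesgue (theta_conv \<theta> K L)) /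
     (root CARD('n) (measure lebesgue K) + root CARD('n) (measure lebesgue L))"
      using pos by (intro divide_nonneg_pos) auto
    then have "root CARD('n) (b K L) = root CARD('n) (measure lebesgue (theta_conv \<theta> K L)) /
     (root CARD('n) (measure lebesgue K) + root CARD('n) (measure lebesgue L))"
      unfolding b_def by (intro real_root_power_cancel n)
    then show ?thesis
      using pos real_root_le_iff[OF n, of c "b K L"] by (simp add: pos_le_divide_eq)
  qed
  have S: "c \<in> S \<longleftrightarrow> 0 \<le> c \<and>
      (\<forall>K L :: (real ^ 'n) set. convex_body K \<longrightarrow> convex_body L \<longrightarrow> c \<le> b K L)" for c
    unfolding S_def admissible_const_def using eq by auto
  have cb: "convex_body (cball 0 1 :: (real ^ 'n) set)"
    by (simp add: convex_body_def)
  have "0 \<in> S"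
    unfolding S_def admissible_const_def by simp
  have bdd: "bdd_above S"
    using S cb by (intro bdd_aboveI) blast
  have ub: "d \<le> Sup S" if "d \<in> S" for d
    using bdd that by (simp add: cSup_upper)
  have "Sup S \<in> S"
    unfolding S using ub[OF \<open>0 \<in> S\<close>] S \<open>0 \<in> S\<close> by (auto intro!: cSup_least)
  then show ?thesis using ub S_def by blast
qed

lemma best_const_admissible: "admissible_const N \<theta> (best_const N \<theta>)"
  and best_const_greatest: "admissible_const N \<theta> c \<Longrightarrow> c \<le> best_const N \<theta>"
proof -
  obtain m where m: "admissible_const N \<theta> m" "\<And>d. admissible_const N \<theta> d \<Longrightarrow> d \<le> m"
    using admissible_greatest_ex by blast
  then have "best_const N \<theta> = m"
    unfolding best_const_def by (intro Greatest_equality)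
  with m show "admissible_const N \<theta> (best_const N \<theta>)"
    and "admissible_const N \<theta> c \<Longrightarrow> c \<le> best_const N \<theta>" by auto
qed

end

theory Submission
  imports Defs
begin

text \<open>Let \<open>f x = |K \<inter> (x - L)|\<close> and let \<open>x\<^sub>0\<close> nearly maximise \<open>f\<close>. By convexity, for \<open>y \<in> K + L\<close> the
  body \<open>K \<inter> ((1 - s) y + s x\<^sub>0 - L)\<close> contains a translate of \<open>s (K \<inter> (x\<^sub>0 - L))\<close>, so
  \<open>f ((1 - s) y + s x\<^sub>0) \<ge> s\<^sup>n f x\<^sub>0\<close>. Hence for every \<open>s\<close> with \<open>s\<^sup>n > \<theta>\<close> the \<open>\<theta>\<close>-convolution contains
  a translate of \<open>(1 - s) (K + L)\<close>; let \<open>s\<close> decrease to the \<open>n\<close>-th root of \<open>\<theta>\<close> and apply the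
  Brunn--Minkowski inequality.

  Brunn--Minkowski is proved by the method of Hadwiger and Ohmann. For two boxes it is the AM-GM inequality.
  For finite disjoint unions \<open>A\<close>, \<open>B\<close> of boxes, a coordinate hyperplane separates two boxes of \<open>A\<close>; a
  parallel hyperplane cuts \<open>B\<close> in the same proportion. The sums of the corresponding halves are
  disjoint parts of \<open>A + B\<close>, and the inequality for the halves adds up to the one for \<open>A\<close> and \<open>B\<close>.
  Bounded open sets are exhausted from inside by such unions.\<close>

subsection \<open>The Brunn--Minkowski inequality for boxes\<close>

text \<open>Superadditivity of the geometric mean. Dividing by the right-hand side turns the two
  terms into geometric means of the ratios \<open>p i / (p i + q i)\<close> and
  \<open>q i / (p i + q i)\<close>; by AM-GM they are at most the arithmetic means, which add up to
  1.\<close>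

lemma root_prod_add_le:
  fixes p q :: "'a \<Rightarrow> real"
  assumes fin: "finite S" and ne: "S \<noteq> {}"
    and p: "\<And>i. i \<in> S \<Longrightarrow> 0 < p i" and q: "\<And>i. i \<in> S \<Longrightarrow> 0 < q i"
  shows "root (card S) (\<Prod>i\<in>S. p i) + root (card S) (\<Prod>i\<in>S. q i)
         \<le> root (card S) (\<Prod>i\<in>S. p i + q i)"
proof -
  have n: "0 < card S" using fin ne by (simp add: card_gt_0_iff)
  have pq: "0 < p i + q i" if "i \<in> S" for i using p[OF that] q[OF that] by simp
  define R where "R = root (card S) (\<Prod>i\<in>S. p i + q i)"
  have R: "0 < R" unfolding R_def using n pq by (simp add: prod_pos)
  have am_gm: "root (card S) (\<Prod>i\<in>S. r i) / R \<le> (\<Sum>i\<in>S. r i / (p i + q i)) / card S"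
    if r: "\<And>i. i \<in> S \<Longrightarrow> 0 < r i" for r
  proof -
    have "root (card S) (\<Prod>i\<in>S. r i) / R = root (card S) (\<Prod>i\<in>S. r i / (p i + q i))"
      unfolding R_def by (simp add: prod_dividef real_root_divide)
    also have "\<dots> = (\<Prod>i\<in>S. r i / (p i + q i)) powr (1 / card S)"
      using n r pq by (intro root_powr_inverse prod_nonneg) (auto simp: less_imp_le)
    also have "\<dots> \<le> (\<Sum>i\<in>S. r i / (p i + q i) / card S)"
      using r pq by (intro arith_geom_mean fin ne) (simp add: less_imp_le)
    finally show ?thesis by (simp add: sum_divide_distrib)
  qed
  have "root (card S) (\<Prod>i\<in>S. p i) / R + root (card S) (\<Prod>i\<in>S. q i) / R
      \<le> (\<Sum>i\<in>S. p i / (p i + q i)) / card S + (\<Sum>i\<in>S. q i / (p i + q i)) / card S"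
    by (intro add_mono am_gm p q)
  also have "\<dots> = (\<Sum>i\<in>S. p i / (p i + q i) + q i / (p i + q i)) / card S"
    by (simp add: sum.distrib add_divide_distrib)
  also have "(\<Sum>i\<in>S. p i / (p i + q i) + q i / (p i + q i)) = (\<Sum>i\<in>S. 1)"
    using pq by (intro sum.cong) (auto simp flip: add_divide_distrib dest: pq)
  also have "\<dots> / card S = 1" using n by simp
  finally have "(root (card S) (\<Prod>i\<in>S. p i) + root (card S) (\<Prod>i\<in>S. q i)) / R \<le> 1"
    by (simp add: add_divide_distrib)
  with R show ?thesis by (simp add: R_def)
qed

text \<open>In each coordinate a point of the large interval divides it in some ratio; the points
  dividing the two small intervals in the same ratio add up to it.\<close>

lemma box_add_box_superset:
  fixes a b c d :: "'a::euclidean_space"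
  assumes "box a b \<noteq> {}" "box c d \<noteq> {}"
  shows "box (a + c) (b + d) \<subseteq> box a b + box c d"
proof
  fix x assume x: "x \<in> box (a + c) (b + d)"
  have ab: "a \<bullet> i < b \<bullet> i" and cd: "c \<bullet> i < d \<bullet> i" if "i \<in> Basis" for i
    using assms that by (auto simp: box_ne_empty)
  \<comment> \<open>The relative position of \<open>x\<close> along side \<open>i\<close> of the
    summed box, strictly between 0 and 1; both summands \<open>y\<close> and \<open>z\<close> reuse
    it.\<close>
  define s where "s i = (x \<bullet> i - a \<bullet> i - c \<bullet> i) / (b \<bullet> i - a \<bullet> i + (d \<bullet> i - c \<bullet> i))" for i
  have s: "0 < s i" "s i < 1" if "i \<in> Basis" for i
    using x ab[OF that] cd[OF that] that
    by (auto simp: s_def mem_box inner_add_left field_simps)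
  have seq: "x \<bullet> i = a \<bullet> i + c \<bullet> i + s i * (b \<bullet> i - a \<bullet> i) + s i * (d \<bullet> i - c \<bullet> i)"
    if "i \<in> Basis" for i
  proof -
    have "b \<bullet> i - a \<bullet> i + (d \<bullet> i - c \<bullet> i) \<noteq> 0" using ab[OF that] cd[OF that] by simp
    then have "s i * (b \<bullet> i - a \<bullet> i + (d \<bullet> i - c \<bullet> i)) = x \<bullet> i - a \<bullet> i - c \<bullet> i"
      by (simp add: s_def)
    then show ?thesis by (simp add: algebra_simps)
  qed
  define y where "y = (\<Sum>i\<in>Basis. (a \<bullet> i + s i * (b \<bullet> i - a \<bullet> i)) *\<^sub>R i)"
  define z where "z = (\<Sum>i\<in>Basis. (c \<bullet> i + s i * (d \<bullet> i - c \<bullet> i)) *\<^sub>R i)"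
  have between: "u < u + t * (v - u)" "u + t * (v - u) < v"
    if "u < v" "0 < t" "t < 1" for u v t :: real
  proof -
    show "u < u + t * (v - u)" using that by simp
    have "t * (v - u) < 1 * (v - u)" using that by (intro mult_strict_right_mono) auto
    then show "u + t * (v - u) < v" by simp
  qed
  have "y \<in> box a b" using ab s between by (simp add: y_def mem_box)
  moreover have "z \<in> box c d" using cd s between by (simp add: z_def mem_box)
  moreover have "x = y + z"
    by (rule euclidean_eqI) (simp add: y_def z_def seq inner_add_left)
  ultimately show "x \<in> box a b + box c d" by (auto intro: set_plus_intro)
qed

lemma open_set_plus:
  fixes A B :: "'a::real_normed_vector set"
  assumes "open A" shows "open (A + B)"
proof -
  have "A + B = (\<Union>x\<in>A. \<Union>y\<in>B. {x + y})" by (auto simp: set_plus_def)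
  then show ?thesis using open_sums[of A B] assms by simp
qed

lemma bounded_set_plus:
  fixes A B :: "'a::real_normed_vector set"
  assumes "bounded A" "bounded B" shows "bounded (A + B)"
proof -
  have "A + B = (\<Union>x\<in>A. \<Union>y\<in>B. {x + y})" by (auto simp: set_plus_def)
  then show ?thesis using bounded_sums[of A B] assms by simp
qed

lemma lmeasurable_set_plus_open:
  fixes A B :: "'a::euclidean_space set"
  assumes "open A" "bounded A" "bounded B"
  shows "A + B \<in> lmeasurable"
  using assms by (simp add: bounded_set_plus lmeasurable_open open_set_plus)

text \<open>The sum contains a box whose side lengths are the sums of the given ones, so
  \<open>root_prod_add_le\<close> applies to the side lengths.\<close>

lemma Brunn_Minkowski_box:
  fixes a b c d :: "'a::euclidean_space"
  assumes ab: "box a b \<noteq> {}" and cd: "box c d \<noteq> {}"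
  shows "root DIM('a) (measure lebesgue (box a b)) + root DIM('a) (measure lebesgue (box c d))
         \<le> root DIM('a) (measure lebesgue (box a b + box c d))"
proof -
  have less: "a \<bullet> i < b \<bullet> i" "c \<bullet> i < d \<bullet> i" if "i \<in> Basis" for i
    using ab cd that by (auto simp: box_ne_empty)
  have "root DIM('a) (measure lebesgue (box a b)) + root DIM('a) (measure lebesgue (box c d))
     = root DIM('a) (\<Prod>i\<in>Basis. (b - a) \<bullet> i) + root DIM('a) (\<Prod>i\<in>Basis. (d - c) \<bullet> i)"
    using less by (simp add: less_imp_le)
  also have "\<dots> \<le> root DIM('a) (\<Prod>i\<in>Basis. (b - a) \<bullet> i + (d - c) \<bullet> i)"
    using less by (intro root_prod_add_le) (auto simp: inner_diff_left)
  also have "(\<Prod>i\<in>Basis. (b - a) \<bullet> i + (d - c) \<bullet> i) = measure lebesgue (box (a + c) (b + d))"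
    using less
    by (simp add: less_imp_le add_mono inner_add_left)
       (simp add: inner_diff_left inner_add_left algebra_simps)
  also have "\<dots> \<le> measure lebesgue (box a b + box c d)"
    using box_add_box_superset[OF ab cd]
    by (intro measure_mono_fmeasurable lmeasurable_set_plus_open) auto
  finally show ?thesis by simp
qed

subsection \<open>Cutting disjoint unions of boxes\<close>

text \<open>Open boxes: cutting by a hyperplane then loses only a null set, and sums of the pieces on
  opposite sides are genuinely disjoint.\<close>

definition box_family :: "'a::euclidean_space set set \<Rightarrow> bool" where
  "box_family D \<longleftrightarrow> finite D \<and> pairwise disjnt D \<and> {} \<notin> D \<and> (\<forall>U\<in>D. \<exists>a b. U = box a b)"

lemma box_family_Union:
  assumes "box_family D"
  shows "open (\<Union>D)" "bounded (\<Union>D)" "\<Union>D \<in> lmeasurable"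
proof -
  show "open (\<Union>D)" using assms by (auto simp: box_family_def intro!: open_Union)
  moreover show "bounded (\<Union>D)" using assms by (auto simp: box_family_def intro!: bounded_Union)
  ultimately show "\<Union>D \<in> lmeasurable" by (simp add: lmeasurable_open)
qed

lemma box_Int_lt_halfspace:
  fixes a b :: "'a::euclidean_space"
  assumes "i \<in> Basis"
  shows "\<exists>b'. box a b \<inter> {x. x \<bullet> i < c} = box a b'"
proof
  let ?b = "\<Sum>j\<in>Basis. (if j = i then min (b \<bullet> j) c else b \<bullet> j) *\<^sub>R j"
  show "box a b \<inter> {x. x \<bullet> i < c} = box a ?b"
    using assms by (auto simp: mem_box split: if_splits)
qed

lemma box_Int_gt_halfspace:
  fixes a b :: "'a::euclidean_space"
  assumes "i \<in> Basis"
  shows "\<exists>a'. box a b \<inter> {x. x \<bullet> i > c} = box a' b"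
proof
  let ?a = "\<Sum>j\<in>Basis. (if j = i then max (a \<bullet> j) c else a \<bullet> j) *\<^sub>R j"
  show "box a b \<inter> {x. x \<bullet> i > c} = box ?a b"
    using assms by (auto simp: mem_box split: if_splits)
qed

text \<open>Used with \<open>H\<close> an open half-space. The boxes that miss \<open>H\<close> are
  dropped, so the count falls strictly as soon as there is one; this drives the induction on the
  number of boxes.\<close>

lemma box_family_restrict:
  assumes D: "box_family D" and H: "\<And>a b. \<exists>a' b'. box a b \<inter> H = box a' b'"
  obtains D' where "box_family D'" "\<Union>D' = \<Union>D \<inter> H" "card D' \<le> card D"
    "(\<exists>U\<in>D. U \<inter> H = {}) \<Longrightarrow> card D' < card D"
proof
  let ?D = "(\<lambda>U. U \<inter> H) ` {U \<in> D. U \<inter> H \<noteq> {}}"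
  have fin: "finite D" using D by (simp add: box_family_def)
  show "box_family ?D"
    unfolding box_family_def
  proof (intro conjI)
    show "pairwise disjnt ?D"
      using D unfolding box_family_def by (auto simp: pairwise_image disjnt_def elim!: pairwise_mono)
    show "\<forall>U\<in>?D. \<exists>a b. U = box a b"
    proof
      fix W assume "W \<in> ?D"
      then obtain U where U: "U \<in> D" "W = U \<inter> H" by blast
      with D obtain a b where "U = box a b" by (auto simp: box_family_def)
      with U H show "\<exists>a b. W = box a b" by auto
    qed
  qed (use fin in auto)
  show "\<Union>?D = \<Union>D \<inter> H" by auto
  have c: "card ?D \<le> card {U \<in> D. U \<inter> H \<noteq> {}}" using fin by (intro card_image_le) auto
  also have "\<dots> \<le> card D" using fin by (intro card_mono) auto
  finally show "card ?D \<le> card D" .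
  assume "\<exists>U\<in>D. U \<inter> H = {}"
  then have "card {U \<in> D. U \<inter> H \<noteq> {}} < card D"
    using fin by (intro psubset_card_mono) auto
  with c show "card ?D < card D" by simp
qed

section \<open>Measure of the pieces cut off by a coordinate hyperplane\<close>

lemma negligible_coordinate_hyperplane:
  fixes i :: "'a::euclidean_space"
  assumes "i \<in> Basis"
  shows "negligible {x. x \<bullet> i = c}"
  using assms negligible_hyperplane[of i c] by (auto simp: inner_commute)

lemma measure_halfspace_split:
  fixes B :: "'a::euclidean_space set"
  assumes B: "B \<in> lmeasurable" and i: "i \<in> Basis"
  shows "measure lebesgue B
    = measure lebesgue (B \<inter> {x. x \<bullet> i < c}) + measure lebesgue (B \<inter> {x. x \<bullet> i > c})"
proof -
  let ?L = "B \<inter> {x. x \<bullet> i < c}" and ?G = "B \<inter> {x. x \<bullet> i > c}"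
  have meas: "?L \<in> lmeasurable" "?G \<in> lmeasurable"
    using B open_halfspace_component_lt[of i c] open_halfspace_component_gt[of c i]
    by (auto intro!: fmeasurable_Int_fmeasurable simp: borel_open)
  have "measure lebesgue B = measure lebesgue (?L \<union> ?G)"
    using negligible_coordinate_hyperplane[OF i, of c]
    by (intro measure_negligible_symdiff[OF B, symmetric]) (auto elim!: negligible_subset)
  also have "\<dots> = measure lebesgue ?L + measure lebesgue ?G"
    using meas by (subst measure_Un2) (auto intro!: arg_cong[where f = "measure lebesgue"])
  finally show ?thesis .
qed

text \<open>Dominated convergence with the indicator of \<open>B\<close> as the bound: as the cut
  moves to \<open>d\<close>, the indicators converge at every point off the null hyperplane at
  height \<open>d\<close>.\<close>

lemma continuous_measure_lt_halfspace:
  fixes B :: "'a::euclidean_space set"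
  assumes B: "B \<in> lmeasurable" and i: "i \<in> Basis"
  shows "continuous_on UNIV (\<lambda>d. measure lebesgue (B \<inter> {x. x \<bullet> i < d}))"
proof -
  have meas: "B \<inter> {x. x \<bullet> i < d} \<in> lmeasurable" for d
    using B open_halfspace_component_lt[of i d]
    by (auto intro!: fmeasurable_Int_fmeasurable simp: borel_open)
  have "(\<lambda>k. measure lebesgue (B \<inter> {x. x \<bullet> i < u k})) \<longlonglongrightarrow> measure lebesgue (B \<inter> {x. x \<bullet> i < d})"
    if u: "u \<longlonglongrightarrow> d" for u d
  proof -
    have "(\<lambda>k. \<integral>x. (indicator (B \<inter> {x. x \<bullet> i < u k}) x :: real) \<partial>lebesgue)
        \<longlonglongrightarrow> (\<integral>x. indicator (B \<inter> {x. x \<bullet> i < d}) x \<partial>lebesgue)"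
    proof (rule integral_dominated_convergence)
      show "(indicator (B \<inter> {x. x \<bullet> i < d}) :: 'a \<Rightarrow> real) \<in> borel_measurable lebesgue"
        using meas by (intro borel_measurable_indicator) auto
      show "(indicator (B \<inter> {x. x \<bullet> i < u k}) :: 'a \<Rightarrow> real) \<in> borel_measurable lebesgue" for k
        using meas by (intro borel_measurable_indicator) auto
      show "integrable lebesgue (indicator B :: 'a \<Rightarrow> real)"
        using B by (intro integrable_real_indicator) (auto simp: fmeasurable_def)
      show "AE x in lebesgue. norm (indicator (B \<inter> {x. x \<bullet> i < u k}) x :: real) \<le> indicator B x" for k
        by (auto simp: indicator_def)
      have "{x. x \<bullet> i = d} \<in> null_sets lebesgue"
        using negligible_coordinate_hyperplane[OF i] by (simp add: negligible_iff_null_sets)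
      then have "AE x in lebesgue. x \<notin> {x. x \<bullet> i = d}" by (rule AE_not_in)
      then show "AE x in lebesgue. (\<lambda>k. indicator (B \<inter> {x. x \<bullet> i < u k}) x :: real)
          \<longlonglongrightarrow> indicator (B \<inter> {x. x \<bullet> i < d}) x"
      proof eventually_elim
        case (elim x)
        then consider "x \<bullet> i < d" | "d < x \<bullet> i" by fastforce
        \<comment> \<open>Off the hyperplane the cuts \<open>u k\<close> end up on the same side of
          \<open>x\<close> as \<open>d\<close>, so the indicators are eventually constant.\<close>
        then have "eventually (\<lambda>k. x \<bullet> i < u k \<longleftrightarrow> x \<bullet> i < d) sequentially"
        proof cases
          case 1
          with order_tendstoD(1)[OF u 1] show ?thesis by (auto elim: eventually_mono)
        next
          case 2
          with order_tendstoD(2)[OF u 2] show ?thesis by (auto elim: eventually_mono)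
        qed
        then have "eventually (\<lambda>k. (indicator (B \<inter> {x. x \<bullet> i < u k}) x :: real)
            = indicator (B \<inter> {x. x \<bullet> i < d}) x) sequentially"
          by eventually_elim (auto simp: indicator_def)
        then show ?case by (rule tendsto_eventually)
      qed
    qed
    then show ?thesis using meas by simp
  qed
  then show ?thesis
    by (auto simp: continuous_on_sequentially o_def)
qed

text \<open>Intermediate value theorem: a cut below the bounded set \<open>B\<close> gives measure
  0, a cut above it gives all of \<open>B\<close>.\<close>

lemma halfspace_cut_proportion:
  fixes B :: "'a::euclidean_space set"
  assumes B: "B \<in> lmeasurable" "bounded B" and i: "i \<in> Basis" and l: "0 \<le> l" "l \<le> 1"
  obtains d where "measure lebesgue (B \<inter> {x. x \<bullet> i < d}) = l * measure lebesgue B"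
proof -
  let ?g = "\<lambda>d. measure lebesgue (B \<inter> {x. x \<bullet> i < d})"
  obtain R where R: "0 < R" "\<And>x. x \<in> B \<Longrightarrow> norm x < R"
    using B(2) by (auto simp: bounded_pos_less)
  have "\<bar>x \<bullet> i\<bar> < R" if "x \<in> B" for x
    using R(2)[OF that] Basis_le_norm[OF i, of x] by simp
  then have "B \<inter> {x. x \<bullet> i < - R} = {}" "B \<inter> {x. x \<bullet> i < R} = B"
    by fastforce+
  then have "?g (- R) = 0" "?g R = measure lebesgue B" by simp_all
  moreover have "0 \<le> l * measure lebesgue B" "l * measure lebesgue B \<le> measure lebesgue B"
    using l by (auto simp: mult_left_le_one_le)
  moreover have "continuous_on {- R..R} ?g"
    using continuous_measure_lt_halfspace[OF B(1) i] continuous_on_subset by blast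
  ultimately obtain d where "?g d = l * measure lebesgue B"
    using IVT'[of ?g "- R" "l * measure lebesgue B" R] R(1) by auto
  then show thesis using that by blast
qed

section \<open>The Hadwiger-Ohmann induction\<close>

text \<open>Since the cuts have equal proportions, the inequality for a pair of pieces of share
  \<open>m\<close> reads \<open>m * T ^ n \<le> \<mu> (A' + B')\<close>, where \<open>T\<close> is
  the left-hand side of the claim. The shares \<open>l\<close> and \<open>1 - l\<close> add up to 1,
  and the two sums of pieces lie strictly on opposite sides of height \<open>c + d\<close>, so their
  measures add up inside \<open>A + B\<close>.\<close>

lemma Brunn_Minkowski_glue:
  fixes A B :: "'a::euclidean_space set"
  defines "n \<equiv> DIM('a)" and "\<mu> \<equiv> measure (lebesgue :: 'a measure)"
  assumes A: "open A" "bounded A" and B: "open B" "bounded B" and i: "i \<in> Basis"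
    and l: "0 \<le> l" "l \<le> 1"
    and Al: "\<mu> (A \<inter> {x. x \<bullet> i < c}) = l * \<mu> A" and Bl: "\<mu> (B \<inter> {x. x \<bullet> i < d}) = l * \<mu> B"
    and BM_lt: "root n (\<mu> (A \<inter> {x. x \<bullet> i < c})) + root n (\<mu> (B \<inter> {x. x \<bullet> i < d}))
        \<le> root n (\<mu> (A \<inter> {x. x \<bullet> i < c} + B \<inter> {x. x \<bullet> i < d}))"
    and BM_gt: "root n (\<mu> (A \<inter> {x. x \<bullet> i > c})) + root n (\<mu> (B \<inter> {x. x \<bullet> i > d}))
        \<le> root n (\<mu> (A \<inter> {x. x \<bullet> i > c} + B \<inter> {x. x \<bullet> i > d}))"
  shows "root n (\<mu> A) + root n (\<mu> B) \<le> root n (\<mu> (A + B))"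
proof -
  let ?A1 = "A \<inter> {x. x \<bullet> i < c}" and ?A2 = "A \<inter> {x. x \<bullet> i > c}"
  let ?B1 = "B \<inter> {x. x \<bullet> i < d}" and ?B2 = "B \<inter> {x. x \<bullet> i > d}"
  have n: "0 < n" by (simp add: n_def)
  have gt: "\<mu> ?A2 = (1 - l) * \<mu> A" "\<mu> ?B2 = (1 - l) * \<mu> B"
    using measure_halfspace_split[OF _ i, of A c] measure_halfspace_split[OF _ i, of B d] A B Al Bl
    by (auto simp: \<mu>_def lmeasurable_open algebra_simps)
  define T where "T = root n (\<mu> A) + root n (\<mu> B)"
  have T: "0 \<le> T" unfolding T_def \<mu>_def by (intro add_nonneg_nonneg real_root_ge_zero) auto
  have piece: "m * T ^ n \<le> \<mu> (A' + B')"
    if m: "0 \<le> m" and eq: "\<mu> A' = m * \<mu> A" "\<mu> B' = m * \<mu> B"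
      and BM: "root n (\<mu> A') + root n (\<mu> B') \<le> root n (\<mu> (A' + B'))" for m A' B'
  proof -
    have "root n m * T \<le> root n (\<mu> (A' + B'))"
      using BM by (simp add: eq T_def real_root_mult algebra_simps)
    then have "(root n m * T) ^ n \<le> root n (\<mu> (A' + B')) ^ n"
      using m T n by (intro power_mono) auto
    then show ?thesis using m n by (simp add: power_mult_distrib \<mu>_def)
  qed
  have op: "open ?A1" "open ?A2" "open ?B1" "open ?B2"
    using A B open_halfspace_component_lt[of i] open_halfspace_component_gt[of _ i] by auto
  have bd: "bounded ?A1" "bounded ?A2" "bounded ?B1" "bounded ?B2"
    using A B by (auto simp: bounded_Int)
  have lm: "?A1 + ?B1 \<in> lmeasurable" "?A2 + ?B2 \<in> lmeasurable" "A + B \<in> lmeasurable"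
    using op bd A B by (auto intro!: lmeasurable_set_plus_open)
  have "?A1 + ?B1 \<subseteq> {x. x \<bullet> i < c + d}" "?A2 + ?B2 \<subseteq> {x. x \<bullet> i > c + d}"
    by (auto elim!: set_plus_elim simp: inner_add_left)
  then have disj: "(?A1 + ?B1) \<inter> (?A2 + ?B2) = {}" by fastforce
  have "T ^ n = l * T ^ n + (1 - l) * T ^ n" by (simp add: algebra_simps)
  also have "\<dots> \<le> \<mu> (?A1 + ?B1) + \<mu> (?A2 + ?B2)"
    using l Al Bl gt BM_lt BM_gt by (intro add_mono piece) auto
  also have "\<dots> = \<mu> ((?A1 + ?B1) \<union> (?A2 + ?B2))"
    unfolding \<mu>_def using lm disj by (simp add: measure_Un2 Diff_triv Int_commute)
  also have "\<dots> \<le> \<mu> (A + B)"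
    unfolding \<mu>_def using lm
    by (intro measure_mono_fmeasurable) (auto elim!: set_plus_elim intro!: set_plus_intro)
  finally have "root n (T ^ n) \<le> root n (\<mu> (A + B))" using n by simp
  then show ?thesis using real_root_power_cancel[OF n T] by (simp only: T_def)
qed

lemma open_measure_pos:
  fixes A :: "'a::euclidean_space set"
  assumes "open A" "bounded A" "A \<noteq> {}"
  shows "0 < measure lebesgue A"
  using assms open_not_negligible[of A] negligible_iff_measure[of A] lmeasurable_open[of A]
  by (metis measure_nonneg order_le_less)

text \<open>Strong induction on the total number of boxes. If a family has two boxes, a hyperplane
  between them leaves fewer boxes of that family on either side, while the proportional cut of the
  other family does not raise its count. The base case is one box against one box.\<close>

lemma Brunn_Minkowski_box_family:
  fixes D E :: "'a::euclidean_space set set"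
  assumes "box_family D" "box_family E" "D \<noteq> {}" "E \<noteq> {}"
  shows "root DIM('a) (measure lebesgue (\<Union>D)) + root DIM('a) (measure lebesgue (\<Union>E))
         \<le> root DIM('a) (measure lebesgue (\<Union>D + \<Union>E))"
  using assms
proof (induction "card D + card E" arbitrary: D E rule: less_induct)
  case less
  \<comment> \<open>Stated for arbitrary \<open>D'\<close>, \<open>E'\<close> with the same total
    count, so that it also applies with \<open>D\<close> and \<open>E\<close> exchanged.\<close>
  have step: "root DIM('a) (measure lebesgue (\<Union>D')) + root DIM('a) (measure lebesgue (\<Union>E'))
         \<le> root DIM('a) (measure lebesgue (\<Union>D' + \<Union>E'))"
    if sum: "card D' + card E' = card D + card E" and D': "box_family D'" and E': "box_family E'"
      and ne: "E' \<noteq> {}" and UV: "U \<in> D'" "V \<in> D'" "U \<noteq> V" for D' E' :: "'a set set" and U V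
  proof -
    let ?A = "\<Union>D'" and ?B = "\<Union>E'"
    note A = box_family_Union[OF D'] and B = box_family_Union[OF E']
    have "U \<inter> V = {}" "U \<noteq> {}" "V \<noteq> {}" "\<exists>a b. U = box a b" "\<exists>a b. V = box a b"
      using D' UV by (auto simp: box_family_def pairwise_def disjnt_def)
    then obtain a b a' b' where U: "U = box a b" "U \<noteq> {}" and V: "V = box a' b'" "V \<noteq> {}"
      and disj: "box a b \<inter> box a' b' = {}" by blast
    \<comment> \<open>Disjoint nonempty boxes have non-overlapping sides in some coordinate.\<close>
    then obtain i where i: "i \<in> Basis" "b \<bullet> i \<le> a' \<bullet> i \<or> b' \<bullet> i \<le> a \<bullet> i"
      unfolding disjoint_interval box_ne_empty by (metis box_ne_empty(2) not_le)
    \<comment> \<open>\<open>U'\<close> is whichever of the two boxes lies lower, and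
      \<open>c\<close> is its upper end in coordinate \<open>i\<close>.\<close>
    obtain c U' V' where UV': "U' \<in> D'" "V' \<in> D'" "U' \<noteq> {}" "V' \<noteq> {}"
      "U' \<subseteq> {x. x \<bullet> i < c}" "V' \<subseteq> {x. x \<bullet> i > c}"
    proof (cases "b \<bullet> i \<le> a' \<bullet> i")
      case True
      show thesis
        by (rule that[OF UV(1,2) U(2) V(2), of "b \<bullet> i"])
           (use i(1) True in \<open>force simp: U V mem_box\<close>)+
    next
      case False
      with i have "b' \<bullet> i \<le> a \<bullet> i" by simp
      then show thesis
        by (intro that[OF UV(2,1) V(2) U(2), of "b' \<bullet> i"])
           (use i(1) in \<open>force simp: U V mem_box\<close>)+
    qed
    let ?lt = "\<lambda>c. {x. x \<bullet> i < c}" and ?gt = "\<lambda>c. {x. x \<bullet> i > c}"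
    have cut_lt: "\<exists>p q. box u v \<inter> ?lt r = box p q" for u v r using box_Int_lt_halfspace[OF i(1)] by blast
    have cut_gt: "\<exists>p q. box u v \<inter> ?gt r = box p q" for u v r using box_Int_gt_halfspace[OF i(1)] by blast
    have op: "open (?A \<inter> ?lt c)" "open (?A \<inter> ?gt c)"
      using A open_halfspace_component_lt[of i] open_halfspace_component_gt[of _ i] by auto
    have Apos: "0 < measure lebesgue (?A \<inter> ?lt c)" "0 < measure lebesgue (?A \<inter> ?gt c)"
      using UV' A by (intro open_measure_pos op; blast intro: bounded_Int)+
    note split_A = measure_halfspace_split[OF A(3) i(1), of c]
    define l where "l = measure lebesgue (?A \<inter> ?lt c) / measure lebesgue ?A"
    \<comment> \<open>Strictness on both sides matters: it makes both pieces of \<open>?B\<close>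
      nonempty, as the induction hypothesis requires.\<close>
    have l: "0 < l" "l < 1" and Al: "measure lebesgue (?A \<inter> ?lt c) = l * measure lebesgue ?A"
      using Apos split_A by (auto simp: l_def)
    obtain d where Bl: "measure lebesgue (?B \<inter> ?lt d) = l * measure lebesgue ?B"
      using halfspace_cut_proportion[OF B(3) B(2) i(1), of l] l by auto
    have "0 < measure lebesgue ?B"
      using E' ne by (intro open_measure_pos B) (auto simp: box_family_def)
    then have "0 < l * measure lebesgue ?B" "l * measure lebesgue ?B < measure lebesgue ?B"
      using l by auto
    then have Bpos: "0 < measure lebesgue (?B \<inter> ?lt d)" "0 < measure lebesgue (?B \<inter> ?gt d)"
      using Bl measure_halfspace_split[OF B(3) i(1), of d] by linarith+
    \<comment> \<open>The count drops because \<open>V'\<close> misses the lower half-space; for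
      \<open>D2\<close> below, \<open>U'\<close> misses the upper one.\<close>
    obtain D1 where D1: "box_family D1" "\<Union>D1 = ?A \<inter> ?lt c" "card D1 < card D'"
      using box_family_restrict[OF D' cut_lt[of _ _ c]] UV'
      by (metis (no_types, lifting) disjoint_iff mem_Collect_eq not_less_iff_gr_or_eq subset_eq)
    obtain D2 where D2: "box_family D2" "\<Union>D2 = ?A \<inter> ?gt c" "card D2 < card D'"
      using box_family_restrict[OF D' cut_gt[of _ _ c]] UV'
      by (metis (no_types, lifting) disjoint_iff mem_Collect_eq not_less_iff_gr_or_eq subset_eq)
    obtain E1 where E1: "box_family E1" "\<Union>E1 = ?B \<inter> ?lt d" "card E1 \<le> card E'"
      using box_family_restrict[OF E' cut_lt[of _ _ d]] by metis
    obtain E2 where E2: "box_family E2" "\<Union>E2 = ?B \<inter> ?gt d" "card E2 \<le> card E'"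
      using box_family_restrict[OF E' cut_gt[of _ _ d]] by metis
    have ne: "D1 \<noteq> {}" "D2 \<noteq> {}" "E1 \<noteq> {}" "E2 \<noteq> {}"
      using Apos Bpos D1(2) D2(2) E1(2) E2(2) by force+
    show ?thesis
    proof (rule Brunn_Minkowski_glue[OF A(1,2) B(1,2) i(1) _ _ Al Bl])
      show "root DIM('a) (measure lebesgue (?A \<inter> ?lt c)) + root DIM('a) (measure lebesgue (?B \<inter> ?lt d))
          \<le> root DIM('a) (measure lebesgue (?A \<inter> ?lt c + ?B \<inter> ?lt d))"
        using less.hyps[of D1 E1] D1 E1 ne sum by simp
      show "root DIM('a) (measure lebesgue (?A \<inter> ?gt c)) + root DIM('a) (measure lebesgue (?B \<inter> ?gt d))
          \<le> root DIM('a) (measure lebesgue (?A \<inter> ?gt c + ?B \<inter> ?gt d))"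
        using less.hyps[of D2 E2] D2 E2 ne sum by simp
    qed (use l in auto)
  qed
  obtain U V where U: "U \<in> D" and V: "V \<in> E" using less.prems by blast
  consider U' where "U' \<in> D" "U' \<noteq> U" | V' where "V' \<in> E" "V' \<noteq> V" | "D = {U}" "E = {V}"
    using U V by blast
  then show ?case
  proof cases
    case 1
    then show ?thesis using step[of D E U' U] U less.prems by simp
  next
    case 2
    then show ?thesis using step[of E D V' V] V less.prems by (simp add: add.commute)
  next
    case 3
    then have "U \<noteq> {}" "V \<noteq> {}" "\<exists>a b. U = box a b" "\<exists>a b. V = box a b"
      using less.prems U V by (auto simp: box_family_def)
    then show ?thesis using 3 Brunn_Minkowski_box by (metis ccpo_Sup_singleton)
  qed
qed


subsection \<open>The Brunn--Minkowski inequality for open sets and convex bodies\<close>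

text \<open>An open set is a countable union of closed boxes, and finitely many of them already come
  within \<open>e\<close> in measure. Their union is subdivided into closed boxes with disjoint
  interiors; passing to the interiors loses only the null frontiers.\<close>

lemma open_inner_box_family:
  fixes U :: "'a::euclidean_space set"
  assumes U: "open U" "bounded U" and e: "0 < e"
  obtains D where "box_family D" "\<Union>D \<subseteq> U" "measure lebesgue U - e < measure lebesgue (\<Union>D)"
proof -
  have lmU: "U \<in> lmeasurable" using U by (simp add: lmeasurable_open)
  obtain C where C: "countable C" "C \<subseteq> Pow U" "\<And>X. X \<in> C \<Longrightarrow> \<exists>a b. X = cbox a b" "\<Union>C = U"
    using open_countable_Union_open_cbox[OF U(1)] by metis
  obtain F where F: "F \<subseteq> C" "finite F" "measure lebesgue (\<Union>C) - e < measure lebesgue (\<Union>F)"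
  proof (rule measure_countable_Union_approachable[OF C(1) e])
    show "X \<in> lmeasurable" if "X \<in> C" for X using C(3)[OF that] by auto
    show "measure lebesgue (\<Union>D') \<le> measure lebesgue U" if "D' \<subseteq> C" "finite D'" for D'
    proof (rule measure_mono_fmeasurable[OF _ _ lmU])
      show "\<Union>D' \<subseteq> U" using that C(4) by blast
      have "closed (\<Union>D')" using that C(3) by (metis closed_Union closed_cbox subset_eq)
      then show "\<Union>D' \<in> sets lebesgue" by (simp add: borel_closed)
    qed
  qed blast
  obtain P where P: "P division_of \<Union>F"
    using elementary_unions_intervals[OF F(2)] F(1) C(3) by (metis subset_eq)
  note P = division_ofD[OF P]
  let ?D = "interior ` P - {{}}"
  have "box_family ?D"
    unfolding box_family_def
  proof (intro conjI)
    show "pairwise disjnt ?D" using P(5) by (auto simp: pairwise_def disjnt_def)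
    show "\<forall>W\<in>?D. \<exists>a b. W = box a b" using P(4) interior_cbox by fastforce
  qed (use P(1) in auto)
  moreover have sub: "\<Union>?D \<subseteq> \<Union>F" using P(6) interior_subset by fastforce
  moreover have "measure lebesgue (\<Union>F) = measure lebesgue (\<Union>?D)"
  proof (rule measure_negligible_symdiff)
    show "\<Union>?D \<in> lmeasurable" using calculation(1) by (rule box_family_Union)
    have "negligible (\<Union>X\<in>P. frontier X)"
      using P(1,4) by (intro negligible_Union) (auto intro!: negligible_convex_frontier dest!: P(4))
    moreover have "\<Union>F - \<Union>?D \<subseteq> (\<Union>X\<in>P. frontier X)"
    proof
      fix x assume x: "x \<in> \<Union>F - \<Union>?D"
      then obtain X where X: "X \<in> P" "x \<in> X" using P(6) by blast
      then have "x \<in> frontier X" using x closure_subset by (fastforce simp: frontier_def)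
      with X(1) show "x \<in> (\<Union>X\<in>P. frontier X)" by (rule UN_I)
    qed
    ultimately have "negligible (\<Union>F - \<Union>?D)" by (rule negligible_subset)
    moreover have "\<Union>?D - \<Union>F = {}" using sub by (simp only: Diff_eq_empty_iff)
    ultimately show "negligible (\<Union>?D - \<Union>F \<union> (\<Union>F - \<Union>?D))" by (simp only: Un_empty_left)
  qed
  ultimately show thesis
    using that[of ?D] F C(4) by auto
qed

text \<open>Box families inside \<open>U\<close> and \<open>V\<close> give the inequality with both
  measures lowered by \<open>e\<close>; continuity of the root then lets \<open>e\<close> tend to
  0.\<close>

theorem Brunn_Minkowski_open:
  fixes U V :: "'a::euclidean_space set"
  assumes U: "open U" "bounded U" "U \<noteq> {}" and V: "open V" "bounded V" "V \<noteq> {}"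
  shows "root DIM('a) (measure lebesgue U) + root DIM('a) (measure lebesgue V)
         \<le> root DIM('a) (measure lebesgue (U + V))"
proof -
  let ?\<mu> = "measure (lebesgue :: 'a measure)"
  have pos: "0 < ?\<mu> U" "0 < ?\<mu> V" by (intro open_measure_pos U V)+
  let ?h = "\<lambda>e. root DIM('a) (?\<mu> U - e) + root DIM('a) (?\<mu> V - e)"
  have "(?h \<longlongrightarrow> ?h 0) (at_right 0)"
    by (intro tendsto_intros)
  moreover have "eventually (\<lambda>e. ?h e \<le> root DIM('a) (?\<mu> (U + V))) (at_right 0)"
  proof -
    \<comment> \<open>The bound on \<open>e\<close> forces both inner families to have positive
      measure, hence to be nonempty.\<close>
    have "?h e \<le> root DIM('a) (?\<mu> (U + V))" if e: "0 < e" "e < min (?\<mu> U) (?\<mu> V)" for e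
    proof -
      obtain D where D: "box_family D" "\<Union>D \<subseteq> U" "?\<mu> U - e < ?\<mu> (\<Union>D)"
        using open_inner_box_family[OF U(1,2) e(1)] .
      obtain E where E: "box_family E" "\<Union>E \<subseteq> V" "?\<mu> V - e < ?\<mu> (\<Union>E)"
        using open_inner_box_family[OF V(1,2) e(1)] .
      have ne: "D \<noteq> {}" "E \<noteq> {}" using D(3) E(3) e(2) by auto
      have "?h e \<le> root DIM('a) (?\<mu> (\<Union>D)) + root DIM('a) (?\<mu> (\<Union>E))"
        using D(3) E(3) by (intro add_mono) auto
      also have "\<dots> \<le> root DIM('a) (?\<mu> (\<Union>D + \<Union>E))"
        by (intro Brunn_Minkowski_box_family D E ne)
      also have "\<dots> \<le> root DIM('a) (?\<mu> (U + V))"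
      proof -
        have "?\<mu> (\<Union>D + \<Union>E) \<le> ?\<mu> (U + V)"
          using box_family_Union[OF D(1)] box_family_Union[OF E(1)] U V D(2) E(2)
          by (intro measure_mono_fmeasurable set_plus_mono2 fmeasurableD lmeasurable_set_plus_open)
        then show ?thesis by simp
      qed
      finally show ?thesis .
    qed
    then show ?thesis
      using pos by (auto simp: eventually_at_right_field intro!: exI[of _ "min (?\<mu> U) (?\<mu> V)"])
  qed
  ultimately have "?h 0 \<le> root DIM('a) (?\<mu> (U + V))"
    by (intro tendsto_upperbound) auto
  then show ?thesis by simp
qed

lemma compact_set_plus:
  fixes A B :: "'a::real_normed_vector set"
  assumes "compact A" "compact B" shows "compact (A + B)"
proof -
  have "A + B = (\<Union>x\<in>A. \<Union>y\<in>B. {x + y})" by (auto simp: set_plus_def)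
  then show ?thesis using compact_sums'[OF assms] by simp
qed

text \<open>The frontier of a convex set is null, so the bodies may be replaced by their interiors,
  whose sum lies in \<open>K + L\<close>.\<close>

theorem Brunn_Minkowski_convex_body:
  fixes K L :: "(real ^ 'n::finite) set"
  assumes K: "convex_body K" and L: "convex_body L"
  shows "root CARD('n) (measure lebesgue K) + root CARD('n) (measure lebesgue L)
         \<le> root CARD('n) (measure lebesgue (K + L))"
proof -
  have int: "measure lebesgue (interior C) = measure lebesgue C" "open (interior C)"
    "bounded (interior C)" "interior C \<noteq> {}" if "convex_body C" for C :: "(real ^ 'n) set"
  proof -
    have C: "compact C" "convex C" "interior C \<noteq> {}" using that by (auto simp: convex_body_def)
    show "measure lebesgue (interior C) = measure lebesgue C"
      using negligible_convex_frontier[OF C(2)] closure_subset[of C] interior_subset[of C]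
      by (intro measure_negligible_symdiff lmeasurable_compact C(1))
         (auto simp: frontier_def elim!: negligible_subset)
    show "bounded (interior C)" using C(1) bounded_interior compact_imp_bounded by blast
  qed (use that in \<open>auto simp: convex_body_def\<close>)
  have "root CARD('n) (measure lebesgue K) + root CARD('n) (measure lebesgue L)
      = root CARD('n) (measure lebesgue (interior K)) + root CARD('n) (measure lebesgue (interior L))"
    using int K L by simp
  also have "\<dots> \<le> root CARD('n) (measure lebesgue (interior K + interior L))"
    using Brunn_Minkowski_open[of "interior K" "interior L"] int K L by simp
  also have "\<dots> \<le> root CARD('n) (measure lebesgue (K + L))"
  proof -
    have "measure lebesgue (interior K + interior L) \<le> measure lebesgue (K + L)"
      using K L int
      by (intro measure_mono_fmeasurable set_plus_mono2 fmeasurableD lmeasurable_set_plus_open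
            lmeasurable_compact compact_set_plus interior_subset) (auto simp: convex_body_def)
    then show ?thesis by simp
  qed
  finally show ?thesis .
qed

subsection \<open>The \<open>\<theta>\<close>-convolution\<close>

lemma compact_reflect_translate:
  fixes L :: "'a::real_normed_vector set"
  assumes "compact L" shows "compact ((\<lambda>y. x - y) ` L)"
  by (intro compact_continuous_image assms continuous_intros)

text \<open>The overlap measure is the convolution of the two indicators, hence a Borel function of
  \<open>x\<close>; the set is one of its superlevel sets within the compact \<open>K + L\<close>.
  Monotonicity of measure can then be used for subsets of the
  \<open>\<theta>\<close>-convolution.\<close>

lemma theta_conv_lmeasurable:
  fixes K L :: "(real ^ 'n::finite) set"
  assumes K: "compact K" and L: "compact L"
  shows "theta_conv \<theta> K L \<in> lmeasurable"
proof -
  have [measurable]: "K \<in> sets borel" "L \<in> sets borel" "K + L \<in> sets borel"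
    using K L by (auto intro!: borel_closed compact_imp_closed compact_set_plus)
  define f where "f x = measure lebesgue (K \<inter> (\<lambda>y. x - y) ` L)" for x
  have f_eq: "f x = (\<integral>y. indicator K y * indicator L (x - y) \<partial>lborel)" for x
  proof -
    have "compact (K \<inter> (\<lambda>y. x - y) ` L)"
      by (intro compact_Int K compact_reflect_translate L)
    then have "K \<inter> (\<lambda>y. x - y) ` L \<in> sets borel" by (simp add: borel_closed compact_imp_closed)
    then have "f x = (\<integral>y. indicator (K \<inter> (\<lambda>y. x - y) ` L) y \<partial>lborel)"
      by (simp add: f_def)
    also have "indicator (K \<inter> (\<lambda>y. x - y) ` L) = (\<lambda>y. indicator K y * indicator L (x - y) :: real)"
      by (force simp: indicator_def fun_eq_iff)
    finally show ?thesis .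
  qed
  have [measurable]: "f \<in> borel_measurable borel"
    unfolding f_eq[abs_def] by measurable
  have "{x \<in> K + L. \<theta> * max_conv K L \<le> f x} = (K + L) \<inter> {x \<in> space borel. \<theta> * max_conv K L \<le> f x}"
    by auto
  also have "\<dots> \<in> sets borel" by measurable
  finally have "theta_conv \<theta> K L \<in> sets borel" by (simp add: theta_conv_def f_def)
  moreover have "bounded (theta_conv \<theta> K L)"
    using compact_imp_bounded[OF compact_set_plus[OF K L]]
    by (rule bounded_subset) (auto simp: theta_conv_def)
  ultimately show ?thesis by (intro bounded_set_imp_lmeasurable) auto
qed

lemma measure_Int_reflect_scale_ge:
  fixes K L :: "(real ^ 'n::finite) set"
  assumes K: "compact K" "convex K" and L: "compact L" "convex L"
    and y: "y \<in> K + L" and s: "0 \<le> s" "s \<le> 1"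
  shows "s ^ CARD('n) * measure lebesgue (K \<inter> (\<lambda>z. x\<^sub>0 - z) ` L)
    \<le> measure lebesgue (K \<inter> (\<lambda>z. ((1 - s) *\<^sub>R y + s *\<^sub>R x\<^sub>0) - z) ` L)"
proof -
  obtain p q where pq: "p \<in> K" "q \<in> L" "y = p + q" using y by (auto elim: set_plus_elim)
  let ?C = "\<lambda>x. K \<inter> (\<lambda>z. x - z) ` L"
  have cpt: "compact (?C x)" for x by (intro compact_Int K compact_reflect_translate L)
  \<comment> \<open>With \<open>y = p + q\<close>, contracting towards \<open>p\<close> in
    \<open>K\<close> corresponds to contracting towards \<open>q\<close> in \<open>L\<close>, so
    convexity keeps both memberships.\<close>
  have "(\<lambda>z. s *\<^sub>R z + (1 - s) *\<^sub>R p) ` ?C x\<^sub>0 \<subseteq> ?C ((1 - s) *\<^sub>R y + s *\<^sub>R x\<^sub>0)"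
  proof
    fix v assume "v \<in> (\<lambda>z. s *\<^sub>R z + (1 - s) *\<^sub>R p) ` ?C x\<^sub>0"
    then obtain l where l: "l \<in> L" "x\<^sub>0 - l \<in> K" "v = s *\<^sub>R (x\<^sub>0 - l) + (1 - s) *\<^sub>R p" by auto
    then have "v \<in> K" using convexD[OF K(2), of "x\<^sub>0 - l" p s "1 - s"] pq s by simp
    moreover have "s *\<^sub>R l + (1 - s) *\<^sub>R q \<in> L"
      using convexD[OF L(2), of l q s "1 - s"] l pq s by simp
    moreover have "v = ((1 - s) *\<^sub>R y + s *\<^sub>R x\<^sub>0) - (s *\<^sub>R l + (1 - s) *\<^sub>R q)"
      by (simp add: l(3) pq(3) algebra_simps)
    ultimately show "v \<in> ?C ((1 - s) *\<^sub>R y + s *\<^sub>R x\<^sub>0)" by blast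
  qed
  moreover have "compact ((\<lambda>z. s *\<^sub>R z + (1 - s) *\<^sub>R p) ` ?C x\<^sub>0)"
    by (intro compact_continuous_image cpt continuous_intros)
  ultimately have "measure lebesgue ((\<lambda>z. s *\<^sub>R z + (1 - s) *\<^sub>R p) ` ?C x\<^sub>0)
      \<le> measure lebesgue (?C ((1 - s) *\<^sub>R y + s *\<^sub>R x\<^sub>0))"
    by (intro measure_mono_fmeasurable fmeasurableD lmeasurable_compact cpt)
  then show ?thesis
    using s measure_lebesgue_affine[of s "(1 - s) *\<^sub>R p" "?C x\<^sub>0"] by simp
qed

text \<open>The slack \<open>\<theta> < r\<close> lets a point with overlap close to the supremum
  stand in for a maximiser, so attainment of the supremum need not be shown.\<close>

lemma theta_conv_approx_maximizer:
  fixes K L :: "(real ^ 'n::finite) set"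
  assumes K: "compact K" "K \<noteq> {}" and L: "compact L" "L \<noteq> {}"
    and \<theta>: "0 \<le> \<theta>" "\<theta> < r"
  obtains x where "x \<in> K + L" "\<theta> * max_conv K L \<le> r * measure lebesgue (K \<inter> (\<lambda>y. x - y) ` L)"
proof -
  let ?f = "\<lambda>x. measure lebesgue (K \<inter> (\<lambda>y. x - y) ` L)"
  have ne: "K + L \<noteq> {}" using K L by (auto simp: set_plus_def)
  have bdd: "bdd_above (?f ` (K + L))"
  proof (rule bdd_aboveI2)
    show "?f x \<le> measure lebesgue K" for x
      by (intro measure_mono_fmeasurable fmeasurableD lmeasurable_compact K compact_Int
            compact_reflect_translate L) auto
  qed
  show thesis
  proof (cases "max_conv K L > 0")
    case True
    then have "\<theta> * max_conv K L / r < max_conv K L" using \<theta> by (simp add: field_simps)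
    then obtain x where "x \<in> K + L" "\<theta> * max_conv K L / r < ?f x"
      using less_cSUP_iff[OF ne bdd] by (auto simp: max_conv_def)
    then show thesis using that \<theta> by (simp add: field_simps)
  next
    case False
    \<comment> \<open>Here the left-hand side is at most 0, so any point serves.\<close>
    obtain x where "x \<in> K + L" using ne by blast
    moreover have "\<theta> * max_conv K L \<le> 0" using False \<theta> by (simp add: mult_nonneg_nonpos)
    moreover have "0 \<le> r * ?f x" using \<theta> by simp
    ultimately show thesis using that by (meson order_trans)
  qed
qed

text \<open>The contraction of \<open>K + L\<close> by the factor \<open>1 - s\<close> towards a
  near-maximiser stays inside the \<open>\<theta>\<close>-convolution.\<close>

lemma theta_conv_measure_ge:
  fixes K L :: "(real ^ 'n::finite) set"
  assumes K: "compact K" "convex K" "K \<noteq> {}" and L: "compact L" "convex L" "L \<noteq> {}"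
    and \<theta>: "0 \<le> \<theta>" "\<theta> < s ^ CARD('n)" and s: "0 \<le> s" "s \<le> 1"
  shows "(1 - s) ^ CARD('n) * measure lebesgue (K + L) \<le> measure lebesgue (theta_conv \<theta> K L)"
proof -
  obtain x\<^sub>0 where x0: "x\<^sub>0 \<in> K + L"
    "\<theta> * max_conv K L \<le> s ^ CARD('n) * measure lebesgue (K \<inter> (\<lambda>y. x\<^sub>0 - y) ` L)"
    using theta_conv_approx_maximizer[OF K(1,3) L(1,3) \<theta>] .
  let ?T = "\<lambda>y. (1 - s) *\<^sub>R y + s *\<^sub>R x\<^sub>0"
  have "?T ` (K + L) \<subseteq> theta_conv \<theta> K L"
  proof
    fix x assume "x \<in> ?T ` (K + L)"
    then obtain y where y: "y \<in> K + L" "x = ?T y" by blast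
    have "x \<in> K + L"
      using convexD[OF convex_set_plus[OF K(2) L(2)] y(1) x0(1), of "1 - s" s] s y(2) by simp
    moreover have "\<theta> * max_conv K L \<le> measure lebesgue (K \<inter> (\<lambda>z. x - z) ` L)"
      using x0(2) measure_Int_reflect_scale_ge[OF K(1,2) L(1,2) y(1) s, of x\<^sub>0] y(2) by simp
    ultimately show "x \<in> theta_conv \<theta> K L" by (simp add: theta_conv_def)
  qed
  moreover have "compact (?T ` (K + L))"
    by (intro compact_continuous_image compact_set_plus K L continuous_intros)
  ultimately have "measure lebesgue (?T ` (K + L)) \<le> measure lebesgue (theta_conv \<theta> K L)"
    by (intro measure_mono_fmeasurable fmeasurableD lmeasurable_compact theta_conv_lmeasurable K L)
  then show ?thesis
    using s measure_lebesgue_affine[of "1 - s" "s *\<^sub>R x\<^sub>0" "K + L"] by simp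
qed

lemma theta_conv_root_ge:
  fixes K L :: "(real ^ 'n::finite) set"
  assumes \<theta>: "0 \<le> \<theta>" "\<theta> \<le> 1" and K: "convex_body K" and L: "convex_body L"
  shows "(1 - root CARD('n) \<theta>) * (root CARD('n) (measure lebesgue K) + root CARD('n) (measure lebesgue L))
     \<le> root CARD('n) (measure lebesgue (theta_conv \<theta> K L))"
\<comment> \<open>For \<open>\<theta> = 1\<close> the factor on the left vanishes; otherwise there
  is room for \<open>s\<close> strictly between \<open>t\<close> and 1, and \<open>s\<close> tends
  to \<open>t\<close> from the right.\<close>
proof (cases "\<theta> = 1")
  case False
  let ?n = "CARD('n)"
  define t where "t = root ?n \<theta>"
  define C where "C = root ?n (measure lebesgue K) + root ?n (measure lebesgue L)"
  have t: "0 \<le> t" "t < 1" "t ^ ?n = \<theta>"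
    using \<theta> False by (auto simp: t_def)
  have body: "compact K" "convex K" "K \<noteq> {}" "compact L" "convex L" "L \<noteq> {}"
    using K L by (auto simp: convex_body_def)
  have "(1 - s) * C \<le> root ?n (measure lebesgue (theta_conv \<theta> K L))" if s: "t < s" "s < 1" for s
  proof -
    have "\<theta> < s ^ ?n" using t s power_strict_mono[of t s ?n] by simp
    then have "(1 - s) ^ ?n * measure lebesgue (K + L) \<le> measure lebesgue (theta_conv \<theta> K L)"
      using s t \<theta> body by (intro theta_conv_measure_ge) auto
    then have "root ?n ((1 - s) ^ ?n * measure lebesgue (K + L))
        \<le> root ?n (measure lebesgue (theta_conv \<theta> K L))" by simp
    then have "(1 - s) * root ?n (measure lebesgue (K + L))
        \<le> root ?n (measure lebesgue (theta_conv \<theta> K L))"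
      using s by (simp add: real_root_mult real_root_power_cancel)
    moreover have "(1 - s) * C \<le> (1 - s) * root ?n (measure lebesgue (K + L))"
      using s Brunn_Minkowski_convex_body[OF K L] by (simp add: C_def)
    ultimately show ?thesis by simp
  qed
  then have "eventually (\<lambda>s. (1 - s) * C \<le> root ?n (measure lebesgue (theta_conv \<theta> K L))) (at_right t)"
    using t(2) by (auto simp: eventually_at_right_field)
  moreover have "((\<lambda>s. (1 - s) * C) \<longlongrightarrow> (1 - t) * C) (at_right t)"
    by (intro tendsto_intros)
  ultimately have "(1 - t) * C \<le> root ?n (measure lebesgue (theta_conv \<theta> K L))"
    by (intro tendsto_upperbound) auto
  then show ?thesis by (simp add: t_def C_def)
qed simp

theorem corollary3p2:
  fixes \<theta> :: real
  assumes "0 \<le> \<theta>" and "\<theta> \<le> 1"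
  shows "(\<forall>K L :: (real ^ 'n::finite) set. convex_body K \<longrightarrow> convex_body L \<longrightarrow>
            root CARD('n) (measure lebesgue (theta_conv \<theta> K L))
              \<ge> (1 - root CARD('n) \<theta>) *
                 (root CARD('n) (measure lebesgue K) + root CARD('n) (measure lebesgue L)))
         \<and> best_const TYPE('n) \<theta> \<ge> (1 - root CARD('n) \<theta>) ^ CARD('n)"
proof
  show *: "\<forall>K L :: (real ^ 'n::finite) set. convex_body K \<longrightarrow> convex_body L \<longrightarrow>
            root CARD('n) (measure lebesgue (theta_conv \<theta> K L))
              \<ge> (1 - root CARD('n) \<theta>) *
                 (root CARD('n) (measure lebesgue K) + root CARD('n) (measure lebesgue L))"
    using theta_conv_root_ge[OF assms] by blast
  \<comment> \<open>Nonnegativity makes the constant admissible and lets the root cancel the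
    power.\<close>
  have "0 \<le> 1 - root CARD('n) \<theta>" using assms by simp
  then have "admissible_const TYPE('n) \<theta> ((1 - root CARD('n) \<theta>) ^ CARD('n))"
    using * by (simp add: admissible_const_def real_root_power_cancel)
  then show "best_const TYPE('n) \<theta> \<ge> (1 - root CARD('n) \<theta>) ^ CARD('n)"
    by (rule best_const_greatest)
qed

end
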